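(* Let $n\ge 4$ be even, let $C_n$ be the cycle on $n$ vertices $x_1,\ldots,x_n$, let $K$ be a field and let $I=I(C_n)\subset S=K[x_1,\ldots,x_n]$ be its edge ideal. Then $\mathrm v(I^{k})=2k-1$ for all $k\geq \lfloor\frac{n}{2}\rfloor-1=\frac n2-1$.
   Context: $S=\bigoplus_{d\ge 0}S_d$ is graded with $\deg x_i=1$. $C_n$ has edges $\{x_i,x_{i+1}\}$ for $1\le i<n$ and $\{x_n,x_1\}$, so $I(C_n)=\langle x_1x_2,\ldots,x_{n-1}x_n,x_nx_1\rangle$. For a proper graded ideal $I\subset S$, $\mathrm{v}(I):=\min\{d\geq 0\mid \exists f\in S_d,\ \mathfrak{p}\in\operatorname{Ass}(I)\text{ with }(I:f)=\mathfrak{p}\}$, where $\operatorname{Ass}(I)$ is the set of associated primes of $S/I$ and $(I:f)=\{g\in S\mid gf\in I\}$. *)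

theory Defs
  imports "HOL-Algebra.QuotRing" "HOL-Algebra.Ideal_Product" "HOL-Library.Poly_Mapping"
begin

text \<open>
  An exponent vector is a finitely supported map \<^typ>\<open>nat \<Rightarrow>\<^sub>0 nat\<close>, and a polynomial is a finitely
  supported map from exponent vectors to coefficients.  The type provides all variables
  \<open>x\<^sub>0, x\<^sub>1, \<dots>\<close>; the ring \<open>K[x\<^sub>1, \<dots>, x\<^sub>n]\<close> is carved out by its carrier, with \<open>K\<close> the field type \<open>'k\<close>.
\<close>

type_synonym 'k mpoly = "(nat \<Rightarrow>\<^sub>0 nat) \<Rightarrow>\<^sub>0 'k"

definition poly_ring :: "nat \<Rightarrow> 'k::field mpoly ring" where
  "poly_ring n =
     \<lparr>carrier = {f. \<forall>m \<in> Poly_Mapping.keys f. Poly_Mapping.keys m \<subseteq> {1..n}},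
      mult = (*), one = 1, zero = 0, add = (+)\<rparr>"

definition var :: "nat \<Rightarrow> 'k::field mpoly" where
  "var i = Poly_Mapping.single (Poly_Mapping.single i 1) 1"

text \<open>The graded piece \<open>S\<^sub>d\<close>; as usual it contains the zero polynomial.\<close>

definition graded_part :: "nat \<Rightarrow> nat \<Rightarrow> 'k::field mpoly set" where
  "graded_part n d =
     {f \<in> carrier (poly_ring n). \<forall>m \<in> Poly_Mapping.keys f.
        (\<Sum>i \<in> Poly_Mapping.keys m. Poly_Mapping.lookup m i) = d}"

definition cycle_edges :: "nat \<Rightarrow> nat set set" where
  "cycle_edges n = {{i, i + 1} | i. 1 \<le> i \<and> i < n} \<union> {{n, 1}}"

definition edge_ideal :: "nat \<Rightarrow> nat set set \<Rightarrow> 'k::field mpoly set" where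
  "edge_ideal n E =
     Idl\<^bsub>poly_ring n\<^esub> {var i \<otimes>\<^bsub>poly_ring n\<^esub> var j | i j. {i, j} \<in> E}"

definition colon :: "('a, 'b) ring_scheme \<Rightarrow> 'a set \<Rightarrow> 'a \<Rightarrow> 'a set" where
  "colon R I f = {g \<in> carrier R. g \<otimes>\<^bsub>R\<^esub> f \<in> I}"

text \<open>
  Associated primes of the \<open>R\<close>-module \<open>R/I\<close>: the prime ideals that are annihilators of an element.
  The ring \<open>R\<close> acts on \<open>R Quot I\<close> through the projection \<open>r \<mapsto> I +> r\<close>.
\<close>

definition quot_annihilator :: "('a, 'b) ring_scheme \<Rightarrow> 'a set \<Rightarrow> 'a set \<Rightarrow> 'a set" where
  "quot_annihilator R I u =
     {r \<in> carrier R. (I +>\<^bsub>R\<^esub> r) \<otimes>\<^bsub>R Quot I\<^esub> u = \<zero>\<^bsub>R Quot I\<^esub>}"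

definition associated_primes :: "('a, 'b) ring_scheme \<Rightarrow> 'a set \<Rightarrow> 'a set set" where
  "associated_primes R I =
     {P. primeideal P R \<and> (\<exists>u \<in> carrier (R Quot I). P = quot_annihilator R I u)}"

definition v_number :: "nat \<Rightarrow> 'k::field mpoly set \<Rightarrow> nat" where
  "v_number n I =
     (LEAST d. \<exists>f \<in> graded_part n d. \<exists>P \<in> associated_primes (poly_ring n) I.
        colon (poly_ring n) I f = P)"

lemma poly_ring_simps [simp]:
  "\<one>\<^bsub>poly_ring n\<^esub> = 1" "\<zero>\<^bsub>poly_ring n\<^esub> = 0"
  "f \<otimes>\<^bsub>poly_ring n\<^esub> g = f * g" "f \<oplus>\<^bsub>poly_ring n\<^esub> g = f + g"
  by (simp_all add: poly_ring_def)

lemma poly_ring_carrier_iff: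
  "f \<in> carrier (poly_ring n) \<longleftrightarrow> (\<forall>m \<in> Poly_Mapping.keys f. Poly_Mapping.keys m \<subseteq> {1..n})"
  by (simp add: poly_ring_def)

lemma poly_ring_cring: "cring (poly_ring n :: 'k::field mpoly ring)"
proof (rule cringI)
  let ?C = "carrier (poly_ring n :: 'k mpoly ring)"
  have zero: "0 \<in> ?C" and one: "1 \<in> ?C"
    by (simp_all add: poly_ring_carrier_iff)
  have add: "f + g \<in> ?C" if "f \<in> ?C" "g \<in> ?C" for f g
    using that Poly_Mapping.keys_add[of f g] unfolding poly_ring_carrier_iff by blast
  have uminus: "- f \<in> ?C" if "f \<in> ?C" for f
    using that by (simp add: poly_ring_carrier_iff in_keys_iff)
  have mult: "f * g \<in> ?C" if "f \<in> ?C" "g \<in> ?C" for f g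
    unfolding poly_ring_carrier_iff
  proof
    fix m assume "m \<in> Poly_Mapping.keys (f * g)"
    then obtain a b where "m = a + b" "a \<in> Poly_Mapping.keys f" "b \<in> Poly_Mapping.keys g"
      using Poly_Mapping.keys_mult[of f g] by blast
    then show "Poly_Mapping.keys m \<subseteq> {1..n}"
      using that Poly_Mapping.keys_add[of a b] unfolding poly_ring_carrier_iff by blast
  qed
  show "abelian_group (poly_ring n :: 'k mpoly ring)"
  proof (rule abelian_groupI)
    fix f assume f: "f \<in> ?C"
    show "\<exists>g \<in> ?C. g \<oplus>\<^bsub>poly_ring n\<^esub> f = \<zero>\<^bsub>poly_ring n\<^esub>"
      using uminus[OF f] by (intro bexI[of _ "- f"]) simp_all
  qed (simp_all add: add zero ac_simps)
  show "comm_monoid (poly_ring n :: 'k mpoly ring)"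
    by (rule comm_monoidI) (simp_all add: mult one ac_simps)
qed (simp_all add: distrib_right)

end

theory Submission
  imports Defs
begin

text \<open>
  Every generator \<open>x\<^sub>i x\<^sub>j\<close> of \<open>I\<close> has degree \<open>2\<close>, so all monomials occurring in \<open>I^k\<close> have degree at
  least \<open>2k\<close>.  If \<open>(I^k : f)\<close> is prime, it contains \<open>(x\<^sub>i x\<^sub>j)^k\<close> for an edge, hence a variable \<open>x\<close>; as
  \<open>f\<close> is nonzero, \<open>x f\<close> is a nonzero element of \<open>I^k\<close>, and so \<open>deg f \<ge> 2k - 1\<close>.  This is
  \<open>edge_power_prime_colon_degree\<close>; it holds for every graph with an edge.

  For the converse, an even cycle is bipartite, with the even vertices as one side.  Every edge has
  exactly one even endpoint, so all monomials in \<open>I^k\<close> have degree at least \<open>k\<close> in the even variables.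
  Consider a monomial \<open>f\<close> with \<open>k\<close> odd and \<open>k - 1\<close> even factors.  A polynomial \<open>g\<close> with a term free of even
  variables cannot satisfy \<open>g f \<in> I^k\<close>, so \<open>(I^k : f)\<close> is contained in the prime generated by the even
  variables.  Equality holds as soon as \<open>x\<^sub>b f\<close> is a product of \<open>k\<close> edges for every even \<open>b\<close>.

  With \<open>n = 2t + 4\<close> and \<open>k = t + 1 + s\<close>, the choice \<open>f = (x\<^sub>1 x\<^sub>2)^s x\<^sub>1 x\<^sub>2 \<cdots> x\<^bsub>2t+1\<^esub>\<close> works.  Each even
  vertex can be matched together with the path \<open>1, \<dots>, 2t + 1\<close>: an even \<open>b \<le> 2t + 2\<close> is inserted so that
  \<open>1, \<dots>, b\<close> and \<open>b, \<dots>, 2t + 1\<close> are runs of even length, and \<open>b = n\<close> is paired with \<open>1\<close>, leaving the run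
  \<open>2, \<dots>, 2t + 1\<close> (\<open>even_var_mult_path_in_cycle_power\<close>).  The path and one even vertex use up
  \<open>t + 1 = n/2 - 1\<close> edges, which is why \<open>k\<close> must be at least that large for this witness.

  Both degree counts are instances of one notion, the weight of a monomial for an arbitrary weighting
  of the variables.
\<close>

section \<open>Weighted degrees\<close>

definition weight :: "(nat \<Rightarrow> nat) \<Rightarrow> (nat \<Rightarrow>\<^sub>0 nat) \<Rightarrow> nat" where
  "weight w m = (\<Sum>i \<in> Poly_Mapping.keys m. w i * Poly_Mapping.lookup m i)"

text \<open>
  For a weighting with values in \<open>{0, 1}\<close> this is the \<open>d\<close>-th power of the prime ideal generated by the
  variables of weight \<open>1\<close>; for the constant weight \<open>1\<close> it consists of the polynomials of order at least \<open>d\<close>.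
\<close>

definition order_ideal :: "nat \<Rightarrow> (nat \<Rightarrow> nat) \<Rightarrow> nat \<Rightarrow> 'k::field mpoly set" where
  "order_ideal n w d =
     {f \<in> carrier (poly_ring n). \<forall>m \<in> Poly_Mapping.keys f. d \<le> weight w m}"

definition homogeneous_part :: "nat \<Rightarrow> (nat \<Rightarrow> nat) \<Rightarrow> nat \<Rightarrow> 'k::field mpoly set" where
  "homogeneous_part n w d =
     {f \<in> carrier (poly_ring n). \<forall>m \<in> Poly_Mapping.keys f. weight w m = d}"

lemma weight_superset:
  assumes "finite A" "Poly_Mapping.keys m \<subseteq> A"
  shows "weight w m = (\<Sum>i \<in> A. w i * Poly_Mapping.lookup m i)"
  unfolding weight_def using assms
  by (intro sum.mono_neutral_left) (auto simp: in_keys_iff)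

lemma weight_add: "weight w (a + b) = weight w a + weight w b"
proof -
  let ?A = "Poly_Mapping.keys a \<union> Poly_Mapping.keys b"
  have "weight w c = (\<Sum>i \<in> ?A. w i * Poly_Mapping.lookup c i)" if "c \<in> {a, b, a + b}" for c
    using that Poly_Mapping.keys_add[of a b] by (intro weight_superset) auto
  then show ?thesis
    by (simp add: lookup_add distrib_left sum.distrib)
qed

lemma weight_single: "weight w (Poly_Mapping.single i 1) = w i"
  by (simp add: weight_def)

lemma graded_part_eq_homogeneous_part: "graded_part n d = homogeneous_part n (\<lambda>_. 1) d"
  by (simp add: graded_part_def homogeneous_part_def weight_def)

lemma poly_ring_mult_closed:
  fixes f g :: "'k::field mpoly"
  assumes "f \<in> carrier (poly_ring n)" "g \<in> carrier (poly_ring n)"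
  shows "f * g \<in> carrier (poly_ring n)"
proof -
  interpret cring "poly_ring n :: 'k mpoly ring" by (rule poly_ring_cring)
  show ?thesis using m_closed[OF assms] by simp
qed

lemma poly_ring_add_closed:
  fixes f g :: "'k::field mpoly"
  assumes "f \<in> carrier (poly_ring n)" "g \<in> carrier (poly_ring n)"
  shows "f + g \<in> carrier (poly_ring n)"
proof -
  interpret cring "poly_ring n :: 'k mpoly ring" by (rule poly_ring_cring)
  show ?thesis using a_closed[OF assms] by simp
qed

lemma keys_var: "Poly_Mapping.keys (var i :: 'k::field mpoly) = {Poly_Mapping.single i 1}"
  by (simp add: var_def)

lemma var_nonzero: "(var i :: 'k::field mpoly) \<noteq> 0"
  using keys_var[of i] by (metis insert_not_empty keys_zero)

lemma var_closed: "i \<in> {1..n} \<Longrightarrow> (var i :: 'k::field mpoly) \<in> carrier (poly_ring n)"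
  by (simp add: poly_ring_carrier_iff keys_var)

lemma order_ideal_add:
  "f \<in> order_ideal n w d \<Longrightarrow> g \<in> order_ideal n w d \<Longrightarrow> f + g \<in> order_ideal n w d"
  using Poly_Mapping.keys_add[of f g] by (auto simp: order_ideal_def intro: poly_ring_add_closed)

lemma order_ideal_mult:
  fixes f g :: "'k::field mpoly"
  assumes "f \<in> order_ideal n w d" "g \<in> order_ideal n w e"
  shows "f * g \<in> order_ideal n w (d + e)"
proof -
  have "d + e \<le> weight w m" if m: "m \<in> Poly_Mapping.keys (f * g)" for m
  proof -
    obtain a b where "m = a + b" "a \<in> Poly_Mapping.keys f" "b \<in> Poly_Mapping.keys g"
      using m Poly_Mapping.keys_mult[of f g] by blast
    then show ?thesis using assms by (auto simp: order_ideal_def weight_add intro: add_mono)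
  qed
  then show ?thesis using assms by (simp add: order_ideal_def poly_ring_mult_closed)
qed

lemma order_ideal_0: "order_ideal n w 0 = carrier (poly_ring n)"
  by (simp add: order_ideal_def)

lemma order_ideal_ideal: "ideal (order_ideal n w d) (poly_ring n :: 'k::field mpoly ring)"
proof -
  interpret cring "poly_ring n :: 'k mpoly ring" by (rule poly_ring_cring)
  have minus: "\<ominus>\<^bsub>poly_ring n\<^esub> f = - f" if "f \<in> carrier (poly_ring n)" for f :: "'k mpoly"
    using that l_neg[OF that] by (simp add: eq_neg_iff_add_eq_0)
  have "subgroup (order_ideal n w d) (add_monoid (poly_ring n :: 'k mpoly ring))"
  proof (rule add.subgroupI)
    show "order_ideal n w d \<subseteq> carrier (poly_ring n :: 'k mpoly ring)"
      by (auto simp: order_ideal_def)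
    have "0 \<in> order_ideal n w d" by (simp add: order_ideal_def poly_ring_carrier_iff)
    then show "order_ideal n w d \<noteq> {}" by blast
    fix f :: "'k mpoly" assume f: "f \<in> order_ideal n w d"
    then have "f \<in> carrier (poly_ring n)" by (simp add: order_ideal_def)
    from minus[OF this] a_inv_closed[OF this] f
    show "\<ominus>\<^bsub>poly_ring n\<^esub> f \<in> order_ideal n w d" by (simp add: order_ideal_def in_keys_iff)
  qed (auto simp: order_ideal_add)
  then show ?thesis
    using order_ideal_mult[of _ n w d _ 0] order_ideal_mult[of _ n w 0 _ d]
    by (intro idealI) (auto simp: order_ideal_0 ring_axioms)
qed

lemma homogeneous_part_mult:
  fixes f g :: "'k::field mpoly"
  assumes "f \<in> homogeneous_part n w d" "g \<in> homogeneous_part n w e"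
  shows "f * g \<in> homogeneous_part n w (d + e)"
proof -
  have "weight w m = d + e" if m: "m \<in> Poly_Mapping.keys (f * g)" for m
  proof -
    obtain a b where "m = a + b" "a \<in> Poly_Mapping.keys f" "b \<in> Poly_Mapping.keys g"
      using m Poly_Mapping.keys_mult[of f g] by blast
    then show ?thesis using assms by (simp add: homogeneous_part_def weight_add)
  qed
  then show ?thesis using assms by (simp add: homogeneous_part_def poly_ring_mult_closed)
qed

lemma var_homogeneous: "i \<in> {1..n} \<Longrightarrow> (var i :: 'k::field mpoly) \<in> homogeneous_part n w (w i)"
  using weight_single[of w i] by (simp add: homogeneous_part_def var_closed keys_var)

lemma one_homogeneous: "(1 :: 'k::field mpoly) \<in> homogeneous_part n w 0"
  by (simp add: homogeneous_part_def poly_ring_carrier_iff weight_def)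

lemma homogeneous_power:
  fixes f :: "'k::field mpoly"
  assumes "f \<in> homogeneous_part n w d"
  shows "f ^ s \<in> homogeneous_part n w (s * d)"
proof (induction s)
  case (Suc s)
  then show ?case using homogeneous_part_mult[OF assms Suc.IH] by simp
qed (simp add: one_homogeneous)

lemma prod_var_homogeneous:
  assumes "finite A" "A \<subseteq> {1..n}"
  shows "(\<Prod>i \<in> A. var i :: 'k::field mpoly) \<in> homogeneous_part n w (\<Sum>i \<in> A. w i)"
  using assms
proof (induction rule: finite_induct)
  case (insert a A)
  then show ?case
    using homogeneous_part_mult[OF var_homogeneous[of a n w] insert.IH] by simp
qed (simp add: one_homogeneous)

text \<open>
  This is applied to products: a product of two nonzero homogeneous elements is nonzero, so it cannot
  lie in an order ideal beyond its own weight.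
\<close>

lemma homogeneous_in_order_ideal_eq_0:
  fixes f :: "'k::field mpoly"
  assumes "f \<in> homogeneous_part n w d" "f \<in> order_ideal n w e" "d < e"
  shows "f = 0"
proof -
  have "Poly_Mapping.keys f = {}"
    using assms by (fastforce simp: homogeneous_part_def order_ideal_def)
  then show ?thesis by simp
qed

lemma sum_monomials:
  "(\<Sum>m \<in> Poly_Mapping.keys g. Poly_Mapping.single m (Poly_Mapping.lookup g m)) = g"
  by (intro poly_mapping_eqI) (simp add: lookup_sum lookup_single when_def in_keys_iff)

lemma weight_zero_decomposition:
  fixes g :: "'k::field mpoly"
  assumes "g \<in> carrier (poly_ring n)"
  obtains g0 g1 where "g = g0 + g1" "g0 \<in> homogeneous_part n w 0" "g1 \<in> order_ideal n w 1"
proof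
  let ?part = "\<lambda>A. \<Sum>m \<in> A. Poly_Mapping.single m (Poly_Mapping.lookup g m)"
  let ?Z = "{m \<in> Poly_Mapping.keys g. weight w m = 0}"
  let ?P = "{m \<in> Poly_Mapping.keys g. weight w m \<noteq> 0}"
  have keys: "Poly_Mapping.keys (?part A) \<subseteq> A" for A
    using keys_sum[of "\<lambda>m. Poly_Mapping.single m (Poly_Mapping.lookup g m)" A] by (fastforce split: if_splits)
  have "?part ?Z + ?part ?P = ?part (?Z \<union> ?P)"
    by (rule sum.union_disjoint[symmetric]) auto
  also have "?Z \<union> ?P = Poly_Mapping.keys g" by auto
  finally show "g = ?part ?Z + ?part ?P" by (simp add: sum_monomials)
  show "?part ?Z \<in> homogeneous_part n w 0"
    using keys[of ?Z] assms by (fastforce simp: homogeneous_part_def poly_ring_carrier_iff)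
  show "?part ?P \<in> order_ideal n w 1"
    using keys[of ?P] assms by (fastforce simp: order_ideal_def poly_ring_carrier_iff)
qed

text \<open>
  Modulo the ideal each factor can be replaced by its part of weight \<open>0\<close>.  The product of these parts
  again has weight \<open>0\<close> and lies in the ideal, so it vanishes; the polynomial ring is a domain, so
  one of the parts is zero.
\<close>

lemma order_ideal_1_prime: "primeideal (order_ideal n w 1) (poly_ring n :: 'k::field mpoly ring)"
proof (rule primeidealI[OF order_ideal_ideal poly_ring_cring])
  interpret J: ideal "order_ideal n w 1" "poly_ring n :: 'k mpoly ring" by (rule order_ideal_ideal)
  have one: "(1 :: 'k mpoly) \<in> carrier (poly_ring n)"
    using J.one_closed by simp
  have "(1 :: 'k mpoly) \<notin> order_ideal n w 1"
    using homogeneous_in_order_ideal_eq_0[OF one_homogeneous[where 'k='k]] zero_neq_one by fastforce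
  with one show "carrier (poly_ring n :: 'k mpoly ring) \<noteq> order_ideal n w 1" by blast
  fix a b :: "'k mpoly"
  assume ab: "a \<in> carrier (poly_ring n)" "b \<in> carrier (poly_ring n)"
    and "a \<otimes>\<^bsub>poly_ring n\<^esub> b \<in> order_ideal n w 1"
  then have prod: "a * b \<in> order_ideal n w 1" by simp
  obtain a0 a1 where a: "a = a0 + a1" "a0 \<in> homogeneous_part n w 0" "a1 \<in> order_ideal n w 1"
    using ab(1) by (rule weight_zero_decomposition)
  obtain b0 b1 where b: "b = b0 + b1" "b0 \<in> homogeneous_part n w 0" "b1 \<in> order_ideal n w 1"
    using ab(2) by (rule weight_zero_decomposition)
  have "a0 \<in> carrier (poly_ring n)" using a(2) by (simp add: homogeneous_part_def)
  then have rest: "a0 * b1 + a1 * b \<in> order_ideal n w 1"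
    using J.I_l_closed[OF b(3)] J.I_r_closed[OF a(3) ab(2)] by (simp add: order_ideal_add)
  have "a0 * b0 = a * b + - (a0 * b1 + a1 * b)" by (simp add: a b algebra_simps)
  moreover have "- (a0 * b1 + a1 * b) \<in> order_ideal n w 1"
    using rest by (simp add: order_ideal_def poly_ring_carrier_iff in_keys_iff lookup_uminus
        del: minus_add_distrib)
  ultimately have "a0 * b0 \<in> order_ideal n w 1"
    using order_ideal_add[OF prod] by metis
  then have "a0 * b0 = 0"
    using homogeneous_in_order_ideal_eq_0[OF homogeneous_part_mult[OF a(2) b(2)]] by simp
  then show "a \<in> order_ideal n w 1 \<or> b \<in> order_ideal n w 1" using a b by auto
qed

section \<open>Colon ideals and associated primes\<close>

lemma mem_colon_iff:
  "g \<in> colon (poly_ring n) J f \<longleftrightarrow> g \<in> carrier (poly_ring n) \<and> g * f \<in> J"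
  by (simp add: colon_def)

text \<open>
  The annihilator of the class of \<open>f\<close> in the quotient is the colon ideal, so a prime colon ideal is
  automatically associated.
\<close>

lemma colon_eq_quot_annihilator:
  assumes "ideal J R" "f \<in> carrier R"
  shows "colon R J f = quot_annihilator R J (J +>\<^bsub>R\<^esub> f)"
proof -
  interpret ideal J R by fact
  have "J +>\<^bsub>R\<^esub> x = J \<longleftrightarrow> x \<in> J" if "x \<in> carrier R" for x
    using that a_rcos_self a_rcos_const by blast
  then show ?thesis
    using assms(2)
    by (simp add: colon_def quot_annihilator_def FactRing_def rcoset_mult_add cong: conj_cong)
qed

lemma prime_colon_associated:
  assumes "ideal J R" "f \<in> carrier R" "primeideal (colon R J f) R"
  shows "colon R J f \<in> associated_primes R J"
proof -
  interpret ideal J R by fact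
  have "J +>\<^bsub>R\<^esub> f \<in> carrier (R Quot J)"
    using assms(2) by (auto simp: FactRing_simps)
  then show ?thesis
    using assms colon_eq_quot_annihilator[OF assms(1,2)] by (auto simp: associated_primes_def)
qed

section \<open>Powers of edge ideals\<close>

abbreviation edge_power :: "nat \<Rightarrow> nat set set \<Rightarrow> nat \<Rightarrow> 'k::field mpoly set" where
  "edge_power n E k \<equiv> edge_ideal n E [^]\<^bsub>ideals_set (poly_ring n)\<^esub> k"

lemma edge_power_Suc:
  "edge_power n E (Suc k) = edge_power n E k \<cdot>\<^bsub>poly_ring n\<^esub> edge_ideal n E"
  by (simp add: ideals_set_def)

lemma edge_generators_closed:
  assumes "\<Union>E \<subseteq> {1..n}"
  shows "{var i \<otimes>\<^bsub>poly_ring n\<^esub> var j | i j. {i, j} \<in> E} \<subseteq> carrier (poly_ring n :: 'k::field mpoly ring)"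
proof clarify
  fix i j assume "{i, j} \<in> E"
  then have "i \<in> {1..n}" "j \<in> {1..n}" using assms by blast+
  then show "(var i \<otimes>\<^bsub>poly_ring n\<^esub> var j :: 'k mpoly) \<in> carrier (poly_ring n)"
    by (simp only: poly_ring_simps poly_ring_mult_closed var_closed)
qed

lemma edge_ideal_ideal:
  assumes "\<Union>E \<subseteq> {1..n}"
  shows "ideal (edge_ideal n E) (poly_ring n :: 'k::field mpoly ring)"
proof -
  interpret cring "poly_ring n :: 'k mpoly ring" by (rule poly_ring_cring)
  show ?thesis
    unfolding edge_ideal_def by (rule genideal_ideal[OF edge_generators_closed[OF assms]])
qed

lemma edge_power_ideal:
  assumes "\<Union>E \<subseteq> {1..n}"
  shows "ideal (edge_power n E k) (poly_ring n :: 'k::field mpoly ring)"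
proof -
  interpret cring "poly_ring n :: 'k mpoly ring" by (rule poly_ring_cring)
  interpret S: comm_monoid "ideals_set (poly_ring n :: 'k mpoly ring)"
    by (rule ideals_set_is_comm_monoid)
  show ?thesis
    using S.nat_pow_closed[of "edge_ideal n E" k] edge_ideal_ideal[OF assms]
    by (simp add: ideals_set_def)
qed

lemma edge_power_mult:
  fixes f g :: "'k::field mpoly"
  assumes "\<Union>E \<subseteq> {1..n}" "f \<in> edge_power n E j" "g \<in> edge_power n E l"
  shows "f * g \<in> edge_power n E (j + l)"
proof -
  interpret cring "poly_ring n :: 'k mpoly ring" by (rule poly_ring_cring)
  interpret S: comm_monoid "ideals_set (poly_ring n :: 'k mpoly ring)"
    by (rule ideals_set_is_comm_monoid)
  have "edge_ideal n E \<in> carrier (ideals_set (poly_ring n :: 'k mpoly ring))"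
    using edge_ideal_ideal[OF assms(1)] by (simp add: ideals_set_def)
  then have "edge_power n E (j + l) = edge_power n E j \<cdot>\<^bsub>poly_ring n\<^esub> (edge_power n E l :: 'k mpoly set)"
    using S.nat_pow_mult[of "edge_ideal n E" j l] by (simp add: ideals_set_def)
  then show ?thesis using ideal_prod.prod[OF assms(2,3), of "poly_ring n"] by simp
qed

lemma one_in_edge_power_0: "(1 :: 'k::field mpoly) \<in> edge_power n E 0"
  by (simp add: ideals_set_def poly_ring_carrier_iff)

lemma edge_in_edge_power_1:
  assumes "\<Union>E \<subseteq> {1..n}" "{i, j} \<in> E"
  shows "(var i * var j :: 'k::field mpoly) \<in> edge_power n E 1"
proof -
  interpret cring "poly_ring n :: 'k mpoly ring" by (rule poly_ring_cring)
  interpret S: comm_monoid "ideals_set (poly_ring n :: 'k mpoly ring)"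
    by (rule ideals_set_is_comm_monoid)
  have "edge_ideal n E \<in> carrier (ideals_set (poly_ring n :: 'k mpoly ring))"
    using edge_ideal_ideal[OF assms(1)] by (simp add: ideals_set_def)
  then have "edge_power n E 1 = (edge_ideal n E :: 'k mpoly set)"
    using S.nat_pow_Suc[of "edge_ideal n E" 0] S.nat_pow_0 S.l_one by (simp only: One_nat_def)
  moreover have "(var i * var j :: 'k mpoly) \<in> edge_ideal n E"
    unfolding edge_ideal_def using assms(2)
    by (intro subsetD[OF genideal_self[OF edge_generators_closed[OF assms(1)]]]) auto
  ultimately show ?thesis by simp
qed

lemma edge_power_power:
  fixes f :: "'k::field mpoly"
  assumes "\<Union>E \<subseteq> {1..n}" "f \<in> edge_power n E 1"
  shows "f ^ s \<in> edge_power n E s"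
proof (induction s)
  case 0
  then show ?case by (simp only: power_0 one_in_edge_power_0)
next
  case (Suc s)
  show ?case using edge_power_mult[OF assms(1) assms(2) Suc.IH] by (simp only: power_Suc plus_1_eq_Suc)
qed

text \<open>
  The constant weighting with \<open>d = 2\<close> bounds degrees from below.  The indicator of a vertex cover
  with \<open>d = 1\<close> bounds the degree in the variables of the cover.
\<close>

lemma edge_power_subset_order_ideal:
  assumes "\<Union>E \<subseteq> {1..n}" "\<And>i j. {i, j} \<in> E \<Longrightarrow> d \<le> w i + w j"
  shows "(edge_power n E k :: 'k::field mpoly set) \<subseteq> order_ideal n w (k * d)"
proof (induction k)
  case 0
  show ?case by (simp add: ideals_set_def order_ideal_0)
next
  case (Suc k)
  interpret cring "poly_ring n :: 'k mpoly ring" by (rule poly_ring_cring)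
  have "(var i * var j :: 'k mpoly) \<in> order_ideal n w d" if "{i, j} \<in> E" for i j
  proof -
    have "i \<in> {1..n}" "j \<in> {1..n}" using assms(1) that by blast+
    then have "(var i * var j :: 'k mpoly) \<in> homogeneous_part n w (w i + w j)"
      by (intro homogeneous_part_mult var_homogeneous)
    then show ?thesis
      using assms(2)[OF that] by (auto simp: homogeneous_part_def order_ideal_def)
  qed
  then have gen: "edge_ideal n E \<subseteq> (order_ideal n w d :: 'k mpoly set)"
    unfolding edge_ideal_def by (intro genideal_minimal order_ideal_ideal) auto
  show ?case unfolding edge_power_Suc
  proof
    fix f :: "'k mpoly" assume "f \<in> edge_power n E k \<cdot>\<^bsub>poly_ring n\<^esub> edge_ideal n E"
    then show "f \<in> order_ideal n w (Suc k * d)"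
    proof induction
      case (prod i j)
      then show ?case using order_ideal_mult[of i n w "k * d" j d] gen Suc.IH
        by (auto simp: add.commute)
    qed (simp add: order_ideal_add)
  qed
qed

lemma prime_power_mem:
  fixes g :: "'k::field mpoly"
  assumes "primeideal P (poly_ring n)" "g \<in> carrier (poly_ring n)" "g ^ s \<in> P"
  shows "g \<in> P"
proof -
  interpret primeideal P "poly_ring n :: 'k mpoly ring" by fact
  show ?thesis using assms(3)
  proof (induction s)
    case 0
    then have "carrier (poly_ring n) = P" using one_imp_carrier by simp
    then show ?case using I_notcarr by metis
  next
    case (Suc s)
    have "g ^ s \<in> carrier (poly_ring n)"
    proof (induction s)
      case 0
      show ?case by (simp add: poly_ring_carrier_iff)
    next
      case (Suc s)
      then show ?case using poly_ring_mult_closed[OF assms(2)] by simp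
    qed
    then have "g \<in> P \<or> g ^ s \<in> P" using I_prime[OF assms(2), of "g ^ s"] Suc.prems by simp
    then show ?case using Suc.IH by blast
  qed
qed

text \<open>
  A prime colon ideal contains the \<open>k\<close>-th power of an edge monomial, hence some variable \<open>x\<^sub>a\<close>.
  It is a proper ideal, so \<open>f\<close> is nonzero, and then \<open>x\<^sub>a f\<close> is a nonzero element of the \<open>k\<close>-th power,
  homogeneous of degree \<open>d + 1\<close>.
\<close>

lemma edge_power_prime_colon_degree:
  fixes f :: "'k::field mpoly"
  assumes E: "\<Union>E \<subseteq> {1..n}" "{i, j} \<in> E"
    and f: "f \<in> graded_part n d"
    and prime: "primeideal (colon (poly_ring n) (edge_power n E k) f) (poly_ring n)"
  shows "2 * k - 1 \<le> d"
proof -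
  let ?P = "colon (poly_ring n) (edge_power n E k) f"
  have I: "ideal (edge_power n E k) (poly_ring n :: 'k mpoly ring)"
    by (rule edge_power_ideal[OF E(1)])
  have fC: "f \<in> carrier (poly_ring n)" using f by (simp add: graded_part_def)
  have ij: "i \<in> {1..n}" "j \<in> {1..n}" using E by blast+
  have f0: "f \<noteq> 0"
  proof
    assume "f = 0"
    moreover have "(0 :: 'k mpoly) \<in> edge_power n E k"
      using additive_subgroup.zero_closed[OF ideal.axioms(1)[OF I]] by simp
    ultimately have "carrier (poly_ring n) = ?P" by (auto simp only: mem_colon_iff mult_zero_right)
    with primeideal.I_notcarr[OF prime] show False ..
  qed
  have prod_closed: "(var i * var j :: 'k mpoly) \<in> carrier (poly_ring n)"
    by (intro poly_ring_mult_closed var_closed ij)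
  have pow: "(var i * var j :: 'k mpoly) ^ k \<in> edge_power n E k"
    by (rule edge_power_power[OF E(1) edge_in_edge_power_1[OF E]])
  then have "(var i * var j) ^ k * f \<in> edge_power n E k"
    using ideal.I_r_closed[OF I pow fC] by (simp only: poly_ring_simps)
  with ideal.Icarr[OF I pow] have "(var i * var j) ^ k \<in> ?P" by (simp only: mem_colon_iff)
  then have "var i * var j \<in> ?P" by (rule prime_power_mem[OF prime prod_closed])
  then have "var i \<in> ?P \<or> var j \<in> ?P"
    using primeideal.I_prime[OF prime var_closed[OF ij(1)] var_closed[OF ij(2)]]
    by (simp only: poly_ring_simps)
  then obtain a where a: "a \<in> {1..n}" "var a \<in> ?P" using ij by blast
  have "var a * f \<in> edge_power n E k" using a(2) by (simp only: mem_colon_iff)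
  then have "var a * f \<in> order_ideal n (\<lambda>_. 1) (k * 2)"
    using edge_power_subset_order_ideal[OF E(1), of 2 "\<lambda>_. 1" k] by auto
  moreover have "var a * f \<in> homogeneous_part n (\<lambda>_. 1) (1 + d)"
    using homogeneous_part_mult[OF var_homogeneous[OF a(1), of "\<lambda>_. 1"]] f
    by (simp add: graded_part_eq_homogeneous_part)
  moreover have "var a * f \<noteq> 0" using f0 var_nonzero by simp
  ultimately have "\<not> 1 + d < k * 2" using homogeneous_in_order_ideal_eq_0 by blast
  then show ?thesis by linarith
qed

section \<open>Colon ideals generated by variables\<close>

text \<open>Each monomial of positive weight is divisible by a variable of positive weight.\<close>

lemma order_ideal_1_subset_colon:
  fixes f :: "'k::field mpoly"
  assumes "ideal J (poly_ring n)" "\<And>b. b \<in> {1..n} \<Longrightarrow> w b \<noteq> 0 \<Longrightarrow> var b * f \<in> J"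
  shows "order_ideal n w 1 \<subseteq> colon (poly_ring n) J f"
proof
  fix g :: "'k mpoly" assume g: "g \<in> order_ideal n w 1"
  interpret ideal J "poly_ring n :: 'k mpoly ring" by fact
  let ?t = "\<lambda>m. Poly_Mapping.single m (Poly_Mapping.lookup g m)"
  have monomial: "?t m * f \<in> J" if m: "m \<in> Poly_Mapping.keys g" for m
  proof -
    have "weight w m \<noteq> 0" using g m by (auto simp: order_ideal_def)
    then obtain b where b: "b \<in> Poly_Mapping.keys m" "w b \<noteq> 0"
      by (auto simp: weight_def elim: sum.not_neutral_contains_not_neutral)
    have mC: "Poly_Mapping.keys m \<subseteq> {1..n}"
      using g m by (simp add: order_ideal_def poly_ring_carrier_iff)
    define m' where "m' = m - Poly_Mapping.single b 1"
    have "m = Poly_Mapping.single b 1 + m'"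
      using b(1) by (intro poly_mapping_eqI) (auto simp: m'_def lookup_add lookup_minus lookup_single when_def in_keys_iff)
    then have "?t m = Poly_Mapping.single m' (Poly_Mapping.lookup g m) * var b"
      by (simp add: var_def mult_single add.commute)
    moreover have "Poly_Mapping.keys m' \<subseteq> Poly_Mapping.keys m"
      by (auto simp: m'_def in_keys_iff lookup_minus)
    then have "Poly_Mapping.single m' (Poly_Mapping.lookup g m) \<in> carrier (poly_ring n)"
      using mC by (auto simp: poly_ring_carrier_iff)
    ultimately show ?thesis
      using I_l_closed[OF assms(2)[OF _ b(2)]] b(1) mC by (auto simp: mult.assoc)
  qed
  have "(\<Sum>m \<in> A. ?t m * f) \<in> J" if "finite A" "A \<subseteq> Poly_Mapping.keys g" for A
    using that
  proof (induction rule: finite_induct)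
    case empty
    show ?case using additive_subgroup.zero_closed[OF additive_subgroup_axioms] by simp
  next
    case (insert m A)
    then show ?case using additive_subgroup.a_closed[OF additive_subgroup_axioms monomial[of m]] by simp
  qed
  then have "(\<Sum>m \<in> Poly_Mapping.keys g. ?t m) * f \<in> J" by (simp add: sum_distrib_right)
  then show "g \<in> colon (poly_ring n) J f"
    using g by (simp add: sum_monomials colon_def order_ideal_def)
qed

text \<open>
  The element \<open>f\<close> falls short of the weight \<open>k\<close> that \<open>J\<close> demands.  If \<open>g f \<in> J\<close>, then the part of \<open>g\<close> of
  weight \<open>0\<close> multiplies \<open>f\<close> into weight at least \<open>k\<close> without raising its weight, so this part is zero.
\<close>

lemma colon_eq_order_ideal_1:
  fixes f :: "'k::field mpoly"
  assumes J: "ideal J (poly_ring n)" "J \<subseteq> order_ideal n w k"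
    and f: "f \<in> homogeneous_part n w d" "f \<noteq> 0" "d < k"
    and vars: "\<And>b. b \<in> {1..n} \<Longrightarrow> w b \<noteq> 0 \<Longrightarrow> var b * f \<in> J"
  shows "colon (poly_ring n) J f = order_ideal n w 1"
proof
  show sub: "order_ideal n w 1 \<subseteq> colon (poly_ring n) J f"
    using order_ideal_1_subset_colon[OF J(1) vars] .
  show "colon (poly_ring n) J f \<subseteq> order_ideal n w 1"
  proof
    fix g assume g: "g \<in> colon (poly_ring n) J f"
    then have "g \<in> carrier (poly_ring n)" by (simp add: colon_def)
    then obtain g0 g1 where dec: "g = g0 + g1" "g0 \<in> homogeneous_part n w 0" "g1 \<in> order_ideal n w 1"
      by (rule weight_zero_decomposition)
    have "g * f \<in> order_ideal n w k" using g J(2) by (auto simp: colon_def)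
    moreover have "g1 * f \<in> order_ideal n w k" using sub dec(3) J(2) by (auto simp: colon_def)
    then have "- (g1 * f) \<in> order_ideal n w k"
      by (simp add: order_ideal_def poly_ring_carrier_iff in_keys_iff lookup_uminus)
    moreover have "g0 * f = g * f + - (g1 * f)" by (simp add: dec algebra_simps)
    ultimately have "g0 * f \<in> order_ideal n w k" by (simp only: order_ideal_add)
    then have "g0 * f = 0"
      using homogeneous_in_order_ideal_eq_0[OF homogeneous_part_mult[OF dec(2) f(1)]] f(3) by simp
    then show "g \<in> order_ideal n w 1" using f(2) dec by simp
  qed
qed

section \<open>The even cycle\<close>

lemma consecutive_product_in_cycle_power:
  assumes "1 \<le> a" "a + 2 * j \<le> n + 1" "\<Union>(cycle_edges n) \<subseteq> {1..n}"
  shows "(\<Prod>i = a..<a + 2 * j. var i :: 'k::field mpoly) \<in> edge_power n (cycle_edges n) j"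
  using assms(2)
proof (induction j)
  case 0
  show ?case using one_in_edge_power_0 by simp
next
  case (Suc j)
  let ?i = "a + 2 * j"
  have "{?i, ?i + 1} \<in> cycle_edges n"
    using assms(1) Suc.prems by (auto simp: cycle_edges_def)
  from edge_power_mult[OF assms(3) Suc.IH edge_in_edge_power_1[OF assms(3) this]] Suc.prems
  show ?case by (simp add: mult.assoc)
qed

lemma cycle_edges_subset: "n \<ge> 1 \<Longrightarrow> \<Union>(cycle_edges n) \<subseteq> {1..n}"
  by (auto simp: cycle_edges_def)

lemma sum_even_indicator: "(\<Sum>i = 1..<2 * t + 2. of_bool (even i) :: nat) = t"
  by (induction t) auto

text \<open>
  The vertices \<open>1, \<dots>, 2t + 1\<close> together with one even vertex \<open>b\<close> are perfectly matched by edges: for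
  \<open>b = 2j \<le> 2t + 2\<close> the multiset splits into the runs \<open>1, \<dots>, 2j\<close> and \<open>2j, \<dots>, 2t + 1\<close>, both of even
  length, and the last vertex \<open>b = 2t + 4\<close> uses the closing edge of the cycle.
\<close>

lemma even_var_mult_path_in_cycle_power:
  assumes "even b" "b \<in> {1..2 * t + 4}"
  shows "(var b * (\<Prod>i = 1..<2 * t + 2. var i) :: 'k::field mpoly)
           \<in> edge_power (2 * t + 4) (cycle_edges (2 * t + 4)) (t + 1)"
proof -
  define n where "n = 2 * t + 4"
  have E: "\<Union>(cycle_edges n) \<subseteq> {1..n}" by (rule cycle_edges_subset) (simp add: n_def)
  obtain j where j: "b = 2 * j" using assms(1) by blast
  have "(var b * (\<Prod>i = 1..<2 * t + 2. var i) :: 'k mpoly) \<in> edge_power n (cycle_edges n) (t + 1)"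
  proof (cases "j = t + 2")
    case True
    have "{n, 1} \<in> cycle_edges n" by (simp add: cycle_edges_def)
    then have 1: "(var n * var 1 :: 'k mpoly) \<in> edge_power n (cycle_edges n) 1"
      by (rule edge_in_edge_power_1[OF E])
    have 2: "(\<Prod>i = 2..<2 + 2 * t. var i :: 'k mpoly) \<in> edge_power n (cycle_edges n) t"
      by (rule consecutive_product_in_cycle_power[OF _ _ E]) (simp_all add: n_def)
    have "(\<Prod>i = 1..<2 * t + 2. var i :: 'k mpoly) = var 1 * (\<Prod>i = 2..<2 + 2 * t. var i)"
      by (subst prod.atLeast_Suc_lessThan) (simp_all add: numeral_2_eq_2)
    moreover have "b = n" using True j by (simp add: n_def)
    ultimately show ?thesis
      using edge_power_mult[OF E 1 2] by (simp only: mult.assoc add.commute)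
  next
    case False
    have jt: "1 \<le> j" "j \<le> t + 1" using False assms(2) j by auto
    have 1: "(\<Prod>i = 1..<1 + 2 * j. var i :: 'k mpoly) \<in> edge_power n (cycle_edges n) j"
      by (rule consecutive_product_in_cycle_power[OF _ _ E]) (use jt in \<open>simp_all add: n_def\<close>)
    have 2: "(\<Prod>i = 2 * j..<2 * j + 2 * (t + 1 - j). var i :: 'k mpoly)
               \<in> edge_power n (cycle_edges n) (t + 1 - j)"
      by (rule consecutive_product_in_cycle_power[OF _ _ E]) (use jt in \<open>simp_all add: n_def\<close>)
    have "2 * j + 2 * (t + 1 - j) = 2 * t + 2" using jt by simp
    then have "(\<Prod>i = 1..<2 * t + 2. var i :: 'k mpoly)
        = (\<Prod>i = 1..<2 * j. var i) * (\<Prod>i = 2 * j..<2 * j + 2 * (t + 1 - j). var i)"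
      using jt by (simp only: prod.atLeastLessThan_concat)
    moreover have "(\<Prod>i = 1..<1 + 2 * j. var i :: 'k mpoly) = (\<Prod>i = 1..<2 * j. var i) * var b"
      using jt by (simp add: j)
    moreover have "j + (t + 1 - j) = t + 1" using jt by simp
    ultimately show ?thesis
      using edge_power_mult[OF E 1 2] by (simp only: ac_simps)
  qed
  then show ?thesis by (simp only: n_def)
qed

text \<open>
  The factor \<open>(x\<^sub>1 x\<^sub>2)^s\<close> adds \<open>s\<close> edges to every matching of the path and an even vertex, which raises
  the exponent from \<open>t + 1\<close> to \<open>k\<close>.  The weighting singles out the even vertices, which cover each edge
  because \<open>2t + 4\<close> is even.
\<close>

lemma cycle_power_colon_witness:
  assumes "k = t + 1 + s"
  obtains f :: "'k::field mpoly"
  where "f \<in> graded_part (2 * t + 4) (2 * k - 1)"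
    "colon (poly_ring (2 * t + 4)) (edge_power (2 * t + 4) (cycle_edges (2 * t + 4)) k) f
       = order_ideal (2 * t + 4) (\<lambda>i. of_bool (even i)) 1"
proof -
  define n where "n = 2 * t + 4"
  define f :: "'k mpoly" where "f = (var 1 * var 2) ^ s * (\<Prod>i = 1..<2 * t + 2. var i)"
  let ?w = "\<lambda>i. of_bool (even i) :: nat"
  have E: "\<Union>(cycle_edges n) \<subseteq> {1..n}" by (rule cycle_edges_subset) (simp add: n_def)
  have hom: "f \<in> homogeneous_part n w (s * (w 1 + w 2) + (\<Sum>i = 1..<2 * t + 2. w i))" for w
    unfolding f_def
    by (intro homogeneous_part_mult homogeneous_power var_homogeneous prod_var_homogeneous)
      (auto simp: n_def)
  have "s * (1 + 1) + (\<Sum>i = 1..<2 * t + 2. 1) = 2 * k - 1" by (simp add: assms)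
  then have deg: "f \<in> graded_part n (2 * k - 1)"
    using hom[of "\<lambda>_. 1"] by (simp only: graded_part_eq_homogeneous_part)
  have even_weight: "f \<in> homogeneous_part n ?w (k - 1)"
    using hom[of ?w] by (simp add: sum_even_indicator[simplified] assms add.commute)
  have "{1, 1 + 1} \<in> cycle_edges n"
    unfolding cycle_edges_def by (intro UnI1 CollectI exI[of _ 1]) (simp add: n_def)
  then have "{1, 2} \<in> cycle_edges n" by (simp only: one_add_one)
  then have pow: "((var 1 * var 2) ^ s :: 'k mpoly) \<in> edge_power n (cycle_edges n) s"
    by (rule edge_power_power[OF E edge_in_edge_power_1[OF E]])
  have vars: "var b * f \<in> edge_power n (cycle_edges n) k" if "b \<in> {1..n}" "?w b \<noteq> 0" for b
  proof -
    have "(var b * (\<Prod>i = 1..<2 * t + 2. var i) :: 'k mpoly) \<in> edge_power n (cycle_edges n) (t + 1)"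
      unfolding n_def by (rule even_var_mult_path_in_cycle_power) (use that in \<open>auto simp: n_def\<close>)
    from edge_power_mult[OF E this pow] show ?thesis
      unfolding f_def assms by (simp only: ac_simps)
  qed
  have even_endpoint: "\<exists>a \<in> e. even a" if e: "e \<in> cycle_edges n" for e
  proof -
    consider i where "e = {i, i + 1}" | "e = {n, 1}"
      using e unfolding cycle_edges_def by blast
    then show ?thesis by cases (simp_all add: n_def)
  qed
  have even_cover: "1 \<le> ?w i + ?w j" if "{i, j} \<in> cycle_edges n" for i j
    using even_endpoint[OF that] by auto
  have order: "edge_power n (cycle_edges n) k \<subseteq> (order_ideal n ?w k :: 'k mpoly set)"
    using edge_power_subset_order_ideal[OF E even_cover, where k = k] by (simp only: mult_1_right)
  have f0: "f \<noteq> 0" by (simp add: f_def var_nonzero)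
  have "k - 1 < k" using assms by simp
  from colon_eq_order_ideal_1[OF edge_power_ideal[OF E] order even_weight f0 this vars]
  have "colon (poly_ring n) (edge_power n (cycle_edges n) k) f = order_ideal n ?w 1" .
  with deg show ?thesis using that by (simp only: n_def)
qed

theorem corollary5p8:
  fixes n k :: nat and I :: "'k::field mpoly set"
  assumes "n \<ge> 4" and "even n"
    and "I = edge_ideal n (cycle_edges n)"
    and "k \<ge> n div 2 - 1"
  shows "v_number n (I [^]\<^bsub>ideals_set (poly_ring n)\<^esub> k) = 2 * k - 1"
proof -
  have E: "\<Union>(cycle_edges n) \<subseteq> {1..n}" by (rule cycle_edges_subset) (use assms(1) in simp)
  have edge: "{n, 1} \<in> cycle_edges n" by (simp add: cycle_edges_def)
  obtain t s where n: "n = 2 * t + 4" and k: "k = t + 1 + s"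
  proof -
    obtain m where m: "n = 2 * m" using assms(2) by blast
    show ?thesis
    proof (rule that)
      show "n = 2 * (m - 2) + 4" using m assms(1) by simp
      show "k = (m - 2) + 1 + (k - (m - 1))" using m assms(1,4) by simp
    qed
  qed
  obtain f :: "'k mpoly" where f: "f \<in> graded_part n (2 * k - 1)"
    and colon: "colon (poly_ring n) (edge_power n (cycle_edges n) k) f
                  = order_ideal n (\<lambda>i. of_bool (even i)) 1"
    using cycle_power_colon_witness[OF k, folded n] .
  have "f \<in> carrier (poly_ring n)" using f by (simp add: graded_part_def)
  then have assoc: "colon (poly_ring n) (edge_power n (cycle_edges n) k) f
      \<in> associated_primes (poly_ring n) (edge_power n (cycle_edges n) k)"
    by (rule prime_colon_associated[OF edge_power_ideal[OF E]])
      (simp only: colon order_ideal_1_prime)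
  show ?thesis unfolding v_number_def assms(3)
  proof (rule Least_equality)
    show "\<exists>f \<in> graded_part n (2 * k - 1).
        \<exists>P \<in> associated_primes (poly_ring n) (edge_power n (cycle_edges n) k :: 'k mpoly set).
          colon (poly_ring n) (edge_power n (cycle_edges n) k) f = P"
      using f assoc by blast
  next
    fix d
    assume "\<exists>f \<in> graded_part n d.
        \<exists>P \<in> associated_primes (poly_ring n) (edge_power n (cycle_edges n) k :: 'k mpoly set).
          colon (poly_ring n) (edge_power n (cycle_edges n) k) f = P"
    then show "2 * k - 1 \<le> d"
      using edge_power_prime_colon_degree[OF E edge] by (auto simp: associated_primes_def)
  qed
qed

end
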